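(* Let $\{A_1,\dots,A_N\}$, $N<\infty$, be a collection of $n\times n$ matrices with nonnegative real entries, each having spectral radius $1$. Assume that: (1) if $N=2$, the pair $(A_1,A_2)$ is partially commuting, or quasi-commuting, or a Laffey pair; (2) if $N\ge 3$, the collection is quasi-commuting. Let $E'=\{v_1,\dots,v_d\}$ denote the set of common eigenvectors of the collection, and let $\mathcal{LC}(E')$ be the associated set of linear combinations (both described in the context). For any positive integer $p$, let $\omega\in\Sigma_N^p$ and let $A_\omega$ be the matrix associated to the word $\omega$. Then, for any vector $x\in\mathcal{LC}(E')$, there exists an integer $q_\omega\ge 1$ such that $$\lim_{k\to\infty}A_\omega^{k q_\omega}x=\xi_{(x,\omega)},$$ where $\xi_{(x,\omega)}$ is a periodic point of $A_\omega$ whose period divides $q_\omega$. Moreover, when $p\ge N$ and $\omega$ is such that for all $1\le r\le N$ there exists $1\le j\le p$ with $\omega_j=r$, the integer $q_\omega$ and the limiting point $\xi_{(x,\omega)}\in\mathbb{R}^n$ are independent of the choice of $\omega$; that is, for given $x$ there are a single integer $q\ge1$ and a single point $\xi_x\in\mathbb{R}^n$ such that, for all such words $\omega$, $\lim_{k\to\infty}A_\omega^{kq}x=\xi_x$ and $\xi_x$ is a periodic point of $A_\omega$ whose period divides $q$ (i.e. one may take $q_\omega=q$ and $\xi_{(x,\omega)}=\xi_x$).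
   Context: Words and products: $\Sigma_N^p$ is the set of all words $\omega=(\omega_1\omega_2\cdots\omega_p)$ with $\omega_j\in\{1,\dots,N\}$. For $\omega\in\Sigma_N^p$, $A_\omega:=A_{\omega_p}A_{\omega_{p-1}}\cdots A_{\omega_2}A_{\omega_1}$. Commutation notions: $[A,B]:=AB-BA$. A collection $\{A_1,\dots,A_N\}$ is quasi-commuting if for each pair $(r,s)$ of indices both $A_r$ and $A_s$ commute with $[A_r,A_s]$. A pair $(A,B)$ is partially commuting if $A$ and $B$ have common eigenvectors (possibly in $\mathbb{C}^n$). A pair $(A,B)$ is a Laffey pair if $\mathrm{rank}([A,B])=1$. Common eigenvectors: a common eigenvector of the collection is a nonzero vector in $\mathbb{R}^n$ or $\mathbb{C}^n$ that is an eigenvector of every $A_r$ (with eigenvalue possibly depending on $r$). The set of common eigenvectors is listed as $E'=\{v_1,\dots,v_d\}$, $d\le n$, meaning a maximal linearly independent (over $\mathbb{C}$) list of common eigenvectors, chosen so that the non-real ones occur in complex conjugate pairs. Define $$\mathcal{LC}(E')=\{\alpha_1v_1+\cdots+\alpha_dv_d:\ \alpha_j\in\mathbb{C},\ \alpha_{s_1}=\overline{\alpha_{s_2}}\text{ whenever }v_{s_1}=\overline{v_{s_2}}\text{ is a pair of conjugate non-real vectors, and }\alpha_j\in\mathbb{R}\text{ otherwise}\}\subset\mathbb{R}^n.$$ Periodic points: $x$ is a periodic point of a self-map $f$ if $f^q(x)=x$ for some positive integer $q$; the smallest such $q$ is the period of $x$. *)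

theory Defs
  imports "HOL-Analysis.Analysis" "HOL-Combinatorics.Cycles"
begin

definition complex_vec :: "real^'n \<Rightarrow> complex^'n" where
  "complex_vec x = (\<chi> i. complex_of_real (x $ i))"

definition cnj_vec :: "complex^'n \<Rightarrow> complex^'n" where
  "cnj_vec v = (\<chi> i. cnj (v $ i))"

abbreviation real_vec :: "complex^'n \<Rightarrow> bool" where
  "real_vec v \<equiv> v \<in> range complex_vec"

definition eigenvector :: "'a::field^'n^'n \<Rightarrow> 'a^'n \<Rightarrow> 'a \<Rightarrow> bool" where
  "eigenvector M v l \<longleftrightarrow> v \<noteq> 0 \<and> M *v v = l *s v"

text \<open>The eigenvalues of a real matrix are those of its complexification.\<close>

definition spectrum :: "real^'n^'n \<Rightarrow> complex set" where
  "spectrum M = {l. \<exists>v. eigenvector (map_matrix complex_of_real M) v l}"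

definition spectral_radius :: "real^'n^'n \<Rightarrow> real" where
  "spectral_radius M = (SUP l\<in>spectrum M. norm l)"

definition nonneg_matrix :: "real^'n^'n \<Rightarrow> bool" where
  "nonneg_matrix M \<longleftrightarrow> (\<forall>i j. 0 \<le> M $ i $ j)"

text \<open>The operation \<open>*\<close> on \<open>real^'n^'n\<close>, and hence \<open>^\<close>, is entrywise, so powers are taken
  with respect to \<open>**\<close> explicitly.\<close>

primrec matrix_power :: "real^'n^'n \<Rightarrow> nat \<Rightarrow> real^'n^'n" where
  "matrix_power M 0 = mat 1"
| "matrix_power M (Suc k) = M ** matrix_power M k"

definition commutator :: "real^'n^'n \<Rightarrow> real^'n^'n \<Rightarrow> real^'n^'n" where
  "commutator A B = A ** B - B ** A"

definition quasi_commuting :: "(real^'n^'n) set \<Rightarrow> bool" where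
  "quasi_commuting S \<longleftrightarrow> (\<forall>A\<in>S. \<forall>B\<in>S.
     A ** commutator A B = commutator A B ** A \<and>
     B ** commutator A B = commutator A B ** B)"

text \<open>Real common eigenvectors are covered through the embedding of \<open>real^'n\<close>
  into \<open>complex^'n\<close>.\<close>

definition common_eigenvectors :: "(real^'n^'n) set \<Rightarrow> (complex^'n) set" where
  "common_eigenvectors S =
     {v. v \<noteq> 0 \<and> (\<forall>A\<in>S. \<exists>l. eigenvector (map_matrix complex_of_real A) v l)}"

definition partially_commuting :: "real^'n^'n \<Rightarrow> real^'n^'n \<Rightarrow> bool" where
  "partially_commuting A B \<longleftrightarrow> common_eigenvectors {A, B} \<noteq> {}"

definition Laffey_pair :: "real^'n^'n \<Rightarrow> real^'n^'n \<Rightarrow> bool" where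
  "Laffey_pair A B \<longleftrightarrow> rank (commutator A B) = 1"

definition words :: "nat \<Rightarrow> nat \<Rightarrow> nat list set" where
  "words N p = {w. length w = p \<and> set w \<subseteq> {1..N}}"

text \<open>The first letter of the word is the rightmost factor of the product.\<close>

primrec word_matrix :: "(nat \<Rightarrow> real^'n^'n) \<Rightarrow> nat list \<Rightarrow> real^'n^'n" where
  "word_matrix A [] = mat 1"
| "word_matrix A (r # w) = word_matrix A w ** A r"

text \<open>\<open>E\<close> is an admissible choice of the set \<open>E'\<close>: a maximal \<open>\<complex>\<close>-linearly independent set of
  common eigenvectors whose non-real members occur in complex conjugate pairs.\<close>

definition common_eigenvector_list :: "(real^'n^'n) set \<Rightarrow> (complex^'n) set \<Rightarrow> bool" where
  "common_eigenvector_list S E \<longleftrightarrow>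
     finite E \<and> E \<subseteq> common_eigenvectors S \<and> vec.independent E \<and>
     (\<forall>F. E \<subseteq> F \<longrightarrow> F \<subseteq> common_eigenvectors S \<longrightarrow> vec.independent F \<longrightarrow> F = E) \<and>
     (\<forall>v\<in>E. \<not> real_vec v \<longrightarrow> cnj_vec v \<in> E)"

definition LC :: "(complex^'n) set \<Rightarrow> (complex^'n) set" where
  "LC E = {\<Sum>v\<in>E. \<alpha> v *s v | \<alpha>.
     (\<forall>v\<in>E. \<forall>w\<in>E. \<not> real_vec v \<longrightarrow> v = cnj_vec w \<longrightarrow> \<alpha> v = cnj (\<alpha> w)) \<and>
     (\<forall>v\<in>E. real_vec v \<longrightarrow> \<alpha> v \<in> \<real>)}"

lemma cnj_vec_cnj_vec [simp]: "cnj_vec (cnj_vec v) = v"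
  by (simp add: cnj_vec_def vec_eq_iff)

lemma real_vec_iff: "real_vec v \<longleftrightarrow> cnj_vec v = v"
proof
  assume "cnj_vec v = v"
  then have "v = complex_vec (\<chi> i. Re (v $ i))"
    by (auto simp: complex_vec_def cnj_vec_def vec_eq_iff complex_eq_iff)
  then show "real_vec v" by blast
qed (auto simp: complex_vec_def cnj_vec_def)

lemma LC_real:
  assumes "\<And>v. v \<in> E \<Longrightarrow> \<not> real_vec v \<Longrightarrow> cnj_vec v \<in> E"
  shows "LC E \<subseteq> range complex_vec"
proof
  fix x assume "x \<in> LC E"
  then obtain \<alpha> where x: "x = (\<Sum>v\<in>E. \<alpha> v *s v)"
    and np: "\<And>v w. v \<in> E \<Longrightarrow> w \<in> E \<Longrightarrow> \<not> real_vec v \<Longrightarrow> v = cnj_vec w \<Longrightarrow> \<alpha> v = cnj (\<alpha> w)"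
    and re: "\<And>v. v \<in> E \<Longrightarrow> real_vec v \<Longrightarrow> \<alpha> v \<in> \<real>"
    unfolding LC_def by blast
  have E: "cnj_vec v \<in> E" if "v \<in> E" for v
    using assms[OF that] that by (cases "real_vec v") (auto simp: real_vec_iff)
  have a: "\<alpha> (cnj_vec v) = cnj (\<alpha> v)" if "v \<in> E" for v
  proof (cases "real_vec v")
    case True
    then show ?thesis using re[OF that True] by (metis Reals_cnj_iff real_vec_iff)
  next
    case False
    then have "\<not> real_vec (cnj_vec v)" by (metis cnj_vec_cnj_vec real_vec_iff)
    then show ?thesis using np[of "cnj_vec v" v] that E by blast
  qed
  have "cnj_vec x = (\<Sum>v\<in>E. cnj_vec (\<alpha> v *s v))"
    by (simp add: x cnj_vec_def vec_eq_iff)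
  also have "\<dots> = (\<Sum>v\<in>E. \<alpha> (cnj_vec v) *s cnj_vec v)"
  proof (rule sum.cong)
    fix v assume "v \<in> E"
    have "cnj_vec (\<alpha> v *s v) = cnj (\<alpha> v) *s cnj_vec v"
      by (simp add: cnj_vec_def vec_eq_iff)
    then show "cnj_vec (\<alpha> v *s v) = \<alpha> (cnj_vec v) *s cnj_vec v"
      using a[OF \<open>v \<in> E\<close>] by simp
  qed simp
  also have "\<dots> = x"
    unfolding x by (rule sum.reindex_bij_witness[where i = cnj_vec and j = cnj_vec]) (auto simp: E)
  finally show "x \<in> range complex_vec" by (simp add: real_vec_iff)
qed

definition periodic_point :: "('a \<Rightarrow> 'a) \<Rightarrow> 'a \<Rightarrow> bool" where
  "periodic_point f x \<longleftrightarrow> (\<exists>q>0. (f ^^ q) x = x)"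

text \<open>The period of a periodic point is the library's \<open>least_power\<close>.\<close>

abbreviation period :: "('a \<Rightarrow> 'a) \<Rightarrow> 'a \<Rightarrow> nat" where
  "period \<equiv> least_power"

end

theory Submission
  imports Defs
begin

text \<open>Every common eigenvector \<open>v\<close> is an eigenvector of \<open>A\<^sub>\<omega>\<close> for the product of its eigenvalues
  along \<open>\<omega>\<close>, and all these eigenvalues have modulus at most 1. Those of modulus 1 are roots of
  unity, by a form of the Perron--Frobenius theorem for possibly reducible matrices. Hence, for a
  suitable common exponent \<open>q\<close>, the limit keeps exactly the components of \<open>x\<close> whose eigenvalues along
  the word all have modulus 1; once every letter occurs this does not depend on the word.

  For the roots of unity, let \<open>A v = l v\<close> with \<open>norm l = 1\<close> and \<open>u = \<bar>v\<bar>\<close>, so that \<open>d = A u - u \<ge> 0\<close>. If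
  every index in the support of \<open>v\<close> were connected to the support of \<open>d\<close>, then \<open>w = \<Sum>k\<le>K. A^k u\<close> would
  satisfy \<open>A w \<ge> c w\<close> for some \<open>c > 1\<close>, and Brouwer's theorem would give an eigenvalue \<open>\<ge> c\<close>. So some index
  \<open>i\<close> of the support is not connected to \<open>d\<close>; there the triangle inequality is sharp, and following
  nonzero entries of \<open>A\<close> multiplies the phase of \<open>v\<close> by \<open>l\<close> at each step, along a path that must
  eventually repeat.\<close>

abbreviation cmat :: "real^'n^'n \<Rightarrow> complex^'n^'n" where
  "cmat \<equiv> map_matrix complex_of_real"

lemma cmat_mult_complex_vec: "cmat M *v complex_vec x = complex_vec (M *v x)"
  by (simp add: map_matrix_def complex_vec_def matrix_vector_mult_def vec_eq_iff)

lemma cmat_mult: "cmat (M ** L) = cmat M ** cmat L"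
  by (simp add: map_matrix_def matrix_matrix_mult_def vec_eq_iff)

lemma cmat_mat_1: "cmat (mat 1) = mat 1"
  by (simp add: map_matrix_def mat_def vec_eq_iff)

subsection \<open>Eigenvalues and the spectral radius\<close>

text \<open>The supremum defining \<open>spectral_radius\<close> bounds its members only once the
  set is known to be bounded. Summing the eigenvalue equation over all rows in the l1 norm gives the
  sum of the absolute values of all entries as a bound.\<close>

lemma bdd_above_spectrum: "bdd_above (norm ` spectrum M)"
proof -
  have "norm l \<le> (\<Sum>i\<in>UNIV. \<Sum>j\<in>UNIV. \<bar>M $ i $ j\<bar>)" if "l \<in> spectrum M" for l
  proof -
    obtain v where v0: "v \<noteq> 0" and ev: "cmat M *v v = l *s v"
      using \<open>l \<in> spectrum M\<close> by (auto simp: spectrum_def eigenvector_def)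
    define s where "s = (\<Sum>i\<in>UNIV. norm (v $ i))"
    obtain a where "v $ a \<noteq> 0" using v0 by (auto simp: vec_eq_iff)
    then have "s > 0"
      unfolding s_def by (intro sum_pos2[of _ a]) auto
    have sj: "norm (v $ j) \<le> s" for j
      unfolding s_def by (rule member_le_sum) auto
    have "norm l * norm (v $ i) \<le> (\<Sum>j\<in>UNIV. \<bar>M $ i $ j\<bar> * s)" for i
    proof -
      have "l * v $ i = (\<Sum>j\<in>UNIV. of_real (M $ i $ j) * v $ j)"
        using ev by (simp add: vec_eq_iff matrix_vector_mult_def map_matrix_def)
      then have "norm l * norm (v $ i) = norm (\<Sum>j\<in>UNIV. of_real (M $ i $ j) * v $ j)"
        by (metis norm_mult)
      also have "\<dots> \<le> (\<Sum>j\<in>UNIV. \<bar>M $ i $ j\<bar> * s)"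
        by (rule sum_norm_le) (simp add: norm_mult mult_left_mono sj)
      finally show ?thesis .
    qed
    then have "(\<Sum>i\<in>UNIV. norm l * norm (v $ i)) \<le> (\<Sum>i\<in>UNIV. \<Sum>j\<in>UNIV. \<bar>M $ i $ j\<bar> * s)"
      by (rule sum_mono)
    then have "norm l * s \<le> (\<Sum>i\<in>UNIV. \<Sum>j\<in>UNIV. \<bar>M $ i $ j\<bar>) * s"
      by (simp add: s_def sum_distrib_left[symmetric] sum_distrib_right[symmetric])
    then show ?thesis using \<open>s > 0\<close> by simp
  qed
  then show ?thesis unfolding bdd_above_def by blast
qed

lemma norm_eigenvalue_le_spectral_radius:
  assumes "eigenvector (cmat M) v l"
  shows "norm l \<le> spectral_radius M"
  unfolding spectral_radius_def using assms
  by (intro cSUP_upper bdd_above_spectrum) (auto simp: spectrum_def)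

text \<open>One half of the Collatz-Wielandt characterisation. Normalised supereigenvectors for
  \<open>c\<close> form a compact convex set that the normalised action of \<open>M\<close> maps
  into itself; a Brouwer fixed point is a genuine eigenvector, with an eigenvalue at least
  \<open>c\<close>.\<close>

lemma supereigenvector_le_spectral_radius:
  fixes M :: "real^'n^'n"
  assumes nn: "nonneg_matrix M" and w: "\<And>i. 0 \<le> w $ i" "w \<noteq> 0"
    and c: "c > 0" "\<And>i. c * w $ i \<le> (M *v w) $ i"
  shows "c \<le> spectral_radius M"
proof -
  define s :: "real^'n \<Rightarrow> real" where "s x = (\<Sum>i\<in>UNIV. x $ i)" for x
  have s_scale: "s (a *\<^sub>R x) = a * s x" for a x
    by (simp add: s_def sum_distrib_left)
  \<comment> \<open>Keeping the inequality inside \<open>K\<close> ensures that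
    \<open>s (M *v x)\<close> is at least \<open>c > 0\<close> on \<open>K\<close>, so the
    normalisation in \<open>f\<close> below never divides by zero.\<close>
  define K where "K = {x. (\<forall>i. 0 \<le> x $ i) \<and> s x = 1 \<and> (\<forall>i. c * x $ i \<le> (M *v x) $ i)}"
  have cont_M: "continuous_on X (\<lambda>x. M *v x)" for X
    by (intro linear_continuous_on matrix_vector_mul_bounded_linear)
  have cont_s: "continuous_on X (\<lambda>x. s x)" for X
    unfolding s_def by (intro continuous_intros)
  have pos: "s w > 0"
  proof -
    obtain i where "w $ i \<noteq> 0" using w(2) by (auto simp: vec_eq_iff)
    then have "w $ i > 0" using w(1)[of i] by linarith
    then show ?thesis unfolding s_def using w(1) by (intro sum_pos2[of _ i]) auto
  qed
  have mono: "(M *v x) $ i \<le> (M *v y) $ i" if "\<And>i. x $ i \<le> y $ i" for x y i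
    using that nn unfolding matrix_vector_mult_def nonneg_matrix_def
    by (auto intro!: sum_mono mult_left_mono)
  have smono: "s x \<le> s y" if "\<And>i. x $ i \<le> y $ i" for x y
    unfolding s_def using that by (rule sum_mono)
  have "compact K"
  proof (rule compact_eq_bounded_closed[THEN iffD2], intro conjI)
    have "norm x \<le> 1" if "x \<in> K" for x
    proof -
      have "norm x \<le> (\<Sum>i\<in>UNIV. \<bar>x $ i\<bar>)" by (rule norm_le_l1_cart)
      also have "\<dots> = 1" using that by (simp add: K_def s_def)
      finally show ?thesis .
    qed
    then show "bounded K" by (auto simp: bounded_iff)
    show "closed K"
      unfolding K_def
      by (intro closed_Collect_conj closed_Collect_all closed_Collect_le closed_Collect_eq
          continuous_intros cont_s cont_M)
  qed
  moreover have "convex K"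
  proof (rule convexI)
    fix x y and a b :: real assume xy: "x \<in> K" "y \<in> K" and ab: "0 \<le> a" "0 \<le> b" "a + b = 1"
    have "s (a *\<^sub>R x + b *\<^sub>R y) = 1"
      using xy ab by (simp add: s_def K_def sum.distrib sum_distrib_left[symmetric])
    moreover have "c * (a *\<^sub>R x + b *\<^sub>R y) $ i \<le> (M *v (a *\<^sub>R x + b *\<^sub>R y)) $ i" for i
    proof -
      have "a * (c * x $ i) + b * (c * y $ i) \<le> a * (M *v x) $ i + b * (M *v y) $ i"
        using xy ab by (intro add_mono mult_left_mono) (auto simp: K_def)
      then show ?thesis
        by (simp add: matrix_vector_right_distrib matrix_vector_mult_scaleR algebra_simps)
    qed
    ultimately show "a *\<^sub>R x + b *\<^sub>R y \<in> K"
      using xy ab by (auto simp: K_def)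
  qed
  moreover have "(1 / s w) *\<^sub>R w \<in> K"
    using pos w(1) c(2) by (auto simp: K_def s_scale matrix_vector_mult_scaleR divide_right_mono)
  then have "K \<noteq> {}" by blast
  moreover have s_ge: "c \<le> s (M *v x)" if "x \<in> K" for x
  proof -
    have "c = s (c *\<^sub>R x)" using that by (simp add: s_scale K_def)
    also have "\<dots> \<le> s (M *v x)" using that by (intro smono) (simp add: K_def)
    finally show ?thesis .
  qed
  moreover define f where "f x = (1 / s (M *v x)) *\<^sub>R (M *v x)" for x
  have "continuous_on K f"
    unfolding f_def
  proof (intro continuous_intros cont_M)
    show "continuous_on K (\<lambda>x. s (M *v x))"
      by (rule continuous_on_compose2[OF cont_s[of UNIV] cont_M]) auto
    show "\<forall>x\<in>K. s (M *v x) \<noteq> 0" using s_ge c(1) by force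
  qed
  moreover have "f ` K \<subseteq> K"
  proof
    fix y assume "y \<in> f ` K"
    then obtain x where x: "x \<in> K" and y: "y = f x" by blast
    have sp: "s (M *v x) > 0" using s_ge[OF x] c(1) by linarith
    have Mx: "c * x $ i \<le> (M *v x) $ i" "0 \<le> x $ i" for i using x by (auto simp: K_def)
    have Mx0: "0 \<le> (M *v x) $ i" for i
      using Mx[of i] c(1) by (meson mult_nonneg_nonneg order.trans less_imp_le)
    \<comment> \<open>Applying the monotone map \<open>M\<close> to \<open>c x \<le> M x\<close>
      shows that \<open>M x\<close> is again a supereigenvector for the same
      \<open>c\<close>.\<close>
    have "c * (M *v x) $ i \<le> (M *v (M *v x)) $ i" for i
      using mono[of "c *\<^sub>R x" "M *v x" i] Mx by (simp add: matrix_vector_mult_scaleR)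
    then show "y \<in> K"
      using sp Mx0 by (auto simp: K_def y f_def s_scale matrix_vector_mult_scaleR divide_right_mono)
  qed
  ultimately obtain x where x: "x \<in> K" and fx: "f x = x"
    using brouwer[of K f] by blast
  define t where "t = s (M *v x)"
  have t: "c \<le> t" using s_ge[OF x] by (simp add: t_def)
  have "M *v x = t *\<^sub>R x"
  proof -
    have "t *\<^sub>R f x = M *v x" using t c(1) by (simp add: f_def t_def)
    then show ?thesis by (simp add: fx)
  qed
  then have "cmat M *v complex_vec x = of_real t *s complex_vec x"
    by (simp add: cmat_mult_complex_vec) (simp add: complex_vec_def vec_eq_iff)
  moreover have "complex_vec x \<noteq> 0"
  proof
    assume "complex_vec x = 0"
    then have "x = 0" by (simp add: complex_vec_def vec_eq_iff)
    then show False using x by (simp add: K_def s_def)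
  qed
  ultimately have "norm (complex_of_real t) \<le> spectral_radius M"
    by (intro norm_eigenvalue_le_spectral_radius) (simp add: eigenvector_def)
  then show ?thesis using t c(1) by simp
qed

subsection \<open>Peripheral eigenvalues of nonnegative matrices\<close>

text \<open>The equality case of the triangle inequality. After multiplication by
  \<open>cnj a\<close> the total is real and nonnegative, so the nonnegative gaps between norm and
  real part add up to 0 and each one vanishes.\<close>

lemma sgn_eq_of_norm_sum_eq:
  fixes z :: "'a \<Rightarrow> complex"
  assumes fin: "finite S" and sum: "(\<Sum>j\<in>S. z j) = a" and nsum: "(\<Sum>j\<in>S. norm (z j)) = norm a"
    and j: "j \<in> S" "z j \<noteq> 0"
  shows "sgn (z j) = sgn a"
proof -
  define y where "y j = z j * cnj a" for j
  have "(\<Sum>j\<in>S. norm (y j)) = norm a * norm a"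
    by (simp add: y_def norm_mult nsum flip: sum_distrib_right)
  moreover have "(\<Sum>j\<in>S. Re (y j)) = Re (a * cnj a)"
    unfolding y_def Re_sum[symmetric] sum_distrib_right[symmetric] sum ..
  ultimately have "(\<Sum>j\<in>S. norm (y j) - Re (y j)) = norm a * norm a - Re (a * cnj a)"
    by (simp add: sum_subtractf)
  also have "\<dots> = 0"
    by (simp add: complex_mult_cnj cmod_power2 flip: power2_eq_square)
  finally have "\<forall>j\<in>S. norm (y j) - Re (y j) = 0"
    using fin by (subst (asm) sum_nonneg_eq_0_iff) (auto simp: complex_Re_le_cmod)
  then have "norm (y j) = Re (y j)" using j by simp
  then have "y j = of_real (norm (y j))"
    using cmod_power2[of "y j"] by (simp add: complex_eq_iff)
  then have *: "z j * cnj a = of_real (norm (z j) * norm a)"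
    by (simp add: y_def norm_mult)
  have "norm (z j) \<le> norm a"
    unfolding nsum[symmetric] using fin j by (intro member_le_sum) auto
  then have "a \<noteq> 0" using j by auto
  have "z j * (cnj a * a) = of_real (norm (z j) * norm a) * a"
    using * by (metis mult.assoc)
  moreover have "cnj a * a = of_real (norm a * norm a)"
    by (metis complex_norm_square mult.commute power2_eq_square)
  ultimately have "z j * of_real (norm a) = of_real (norm (z j)) * a"
    using \<open>a \<noteq> 0\<close> by simp
  then show ?thesis
    using \<open>a \<noteq> 0\<close> j by (simp add: sgn_eq divide_simps)
qed

lemma sum_pos_imp_ex_pos:
  fixes f :: "'a \<Rightarrow> 'b::ordered_comm_monoid_add"
  assumes "0 < sum f S" and "\<And>k. k \<in> S \<Longrightarrow> 0 \<le> f k"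
  shows "\<exists>k\<in>S. 0 < f k"
  using assms by (metis less_le order.strict_implies_not_eq sum.neutral)

lemma peripheral_eigenvalue_root_of_unity:
  fixes M :: "real^'n^'n"
  assumes nn: "nonneg_matrix M" and rad: "spectral_radius M \<le> 1"
    and ev: "eigenvector (cmat M) v l" and l: "norm l = 1"
  shows "\<exists>m>0. l ^ m = 1"
proof -
  define P where "P k = ((*v) M) ^^ k" for k
  have P0: "P 0 x = x" and PS: "P (Suc k) x = M *v P k x" for x k
    by (simp_all add: P_def)
  have M_nth: "(M *v x) $ i = (\<Sum>j\<in>UNIV. M $ i $ j * x $ j)" for x i
    by (simp add: matrix_vector_mult_def)
  have M0: "0 \<le> M $ i $ j" for i j using nn by (simp add: nonneg_matrix_def)
  have Pnn: "0 \<le> P k x $ i" if "\<And>i. 0 \<le> x $ i" for k x i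
    using that by (induction k arbitrary: i) (auto simp: P0 PS M_nth intro!: sum_nonneg mult_nonneg_nonneg M0)
  define u :: "real^'n" where "u = (\<chi> i. norm (v $ i))"
  have u0: "0 \<le> u $ i" for i by (simp add: u_def)
  have v0: "v \<noteq> 0" using ev by (simp add: eigenvector_def)
  have ev_nth: "(\<Sum>j\<in>UNIV. of_real (M $ i $ j) * v $ j) = l * v $ i" for i
    using ev by (simp add: eigenvector_def vec_eq_iff matrix_vector_mult_def map_matrix_def)
  \<comment> \<open>The defect in the triangle inequality, row by row: \<open>d $ i = 0\<close>
    exactly when row \<open>i\<close> of the eigenvalue equation is sharp.\<close>
  define d where "d = M *v u - u"
  have d0: "0 \<le> d $ i" for i
  proof -
    have "norm (v $ i) = norm (\<Sum>j\<in>UNIV. of_real (M $ i $ j) * v $ j)"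
      unfolding ev_nth by (simp add: norm_mult l)
    also have "\<dots> \<le> (\<Sum>j\<in>UNIV. M $ i $ j * norm (v $ j))"
      by (rule sum_norm_le) (simp add: norm_mult M0)
    finally show ?thesis by (simp add: d_def M_nth u_def)
  qed
  have Pd: "P k d = P (Suc k) u - P k u" for k
    by (induction k) (auto simp: P0 PS d_def matrix_vector_mult_diff_distrib)
  have Pd_step: "0 < P (Suc k) d $ i" if "0 < M $ i $ j" "0 < P k d $ j" for i j k
    unfolding PS M_nth using that
    by (intro sum_pos2[of _ j]) (auto intro!: mult_nonneg_nonneg M0 Pnn d0)
  \<comment> \<open>Indices in the support of \<open>v\<close> from which no path through positive
    entries of \<open>M\<close> leads to a positive entry of \<open>d\<close>.\<close>
  define T where "T = {i. v $ i \<noteq> 0 \<and> (\<forall>k. P k d $ i = 0)}"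
  have "T \<noteq> {}"
  proof
    assume "T = {}"
    have supp_reaches: "\<exists>k. 0 < P k d $ i" if "0 < u $ i" for i
    proof -
      have "v $ i \<noteq> 0" using that by (auto simp: u_def)
      then obtain k where "P k d $ i \<noteq> 0" using \<open>T = {}\<close> by (auto simp: T_def)
      then show ?thesis using Pnn[OF d0, of k i] by (auto simp: less_le)
    qed
    \<comment> \<open>The support of \<open>w\<close> below may exceed that of \<open>u\<close>. An
      index in the support of some \<open>P k u\<close> leads to the support of \<open>u\<close> and
      from there to \<open>d\<close>.\<close>
    have reaches: "\<exists>m. 0 < P m d $ i" if "0 < P k u $ i" for k i
      using that
    proof (induction k arbitrary: i)
      case 0
      then show ?case using supp_reaches by (simp add: P0)
    next
      case (Suc k)
      obtain j where "0 < M $ i $ j * P k u $ j"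
        using sum_pos_imp_ex_pos[OF Suc.prems[unfolded PS M_nth]] M0 Pnn[OF u0] by auto
      then have "0 < M $ i $ j" "0 < P k u $ j"
        using M0[of i j] Pnn[OF u0, of k j] by (auto simp: zero_less_mult_iff)
      then show ?case using Suc.IH Pd_step by blast
    qed
    define \<kappa> where "\<kappa> i = (SOME k. 0 < P k d $ i)" for i
    \<comment> \<open>The sum dominates every \<open>\<kappa> i\<close>, so one cutoff serves all
      indices.\<close>
    define K where "K = (\<Sum>i\<in>UNIV. \<kappa> i)"
    define w where "w = (\<Sum>k\<le>K. P k u)"
    \<comment> \<open>By \<open>Pd\<close> the surplus of \<open>M w\<close> over \<open>w\<close>
      is the sum of the iterated defects, which is positive wherever \<open>w\<close> is.\<close>
    have Mw: "M *v w = w + (\<Sum>k\<le>K. P k d)"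
    proof -
      have "M *v w = (\<Sum>k\<le>K. P (Suc k) u)"
        unfolding w_def PS by (rule linear_sum[OF matrix_vector_mul_linear])
      then show ?thesis by (simp add: w_def Pd sum_subtractf)
    qed
    have w0: "0 \<le> w $ i" for i
      by (auto simp: w_def intro!: sum_nonneg Pnn u0)
    have uw: "u $ i \<le> w $ i" for i
    proof -
      have "P 0 u $ i \<le> (\<Sum>k\<le>K. P k u $ i)"
        by (rule member_le_sum) (auto intro!: Pnn u0)
      then show ?thesis by (simp add: w_def P0)
    qed
    have "w \<noteq> 0"
    proof -
      obtain i where "v $ i \<noteq> 0" using v0 by (auto simp: vec_eq_iff)
      then have "0 < w $ i" using uw[of i] zero_less_norm_iff[of "v $ i"]
        by (simp add: u_def del: zero_less_norm_iff)
      then show ?thesis by auto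
    qed
    have strict: "w $ i < (M *v w) $ i" if pos: "0 < w $ i" for i
    proof -
      obtain k where "0 < P k u $ i"
        using sum_pos_imp_ex_pos[OF pos[unfolded w_def sum_component]] Pnn[OF u0] by auto
      then have "0 < P (\<kappa> i) d $ i"
        unfolding \<kappa>_def by (intro someI_ex[of "\<lambda>k. 0 < P k d $ i"] reaches)
      moreover have "\<kappa> i \<le> K" unfolding K_def by (rule member_le_sum) auto
      ultimately have "0 < (\<Sum>k\<le>K. P k d $ i)"
        by (intro sum_pos2[of _ "\<kappa> i"]) (auto intro!: Pnn d0)
      then show ?thesis by (simp add: Mw)
    qed
    \<comment> \<open>The least growth ratio over the finite support of \<open>w\<close>. The added
      2 keeps the set visibly nonempty and itself exceeds 1.\<close>
    define c where "c = Min (insert 2 ((\<lambda>i. (M *v w) $ i / w $ i) ` {i. 0 < w $ i}))"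
    have "1 < c" unfolding c_def by (auto simp: strict)
    have "c * w $ i \<le> (M *v w) $ i" for i
    proof (cases "0 < w $ i")
      case True
      then have "c \<le> (M *v w) $ i / w $ i" unfolding c_def by (intro Min_le) auto
      then show ?thesis using True by (simp add: field_simps)
    next
      case False
      then have "w $ i = 0" using w0[of i] by linarith
      then show ?thesis by (simp add: M_nth sum_nonneg w0 M0)
    qed
    then have "c \<le> spectral_radius M"
      using \<open>1 < c\<close> \<open>w \<noteq> 0\<close> w0 by (intro supereigenvector_le_spectral_radius[OF nn]) auto
    then show False using rad \<open>1 < c\<close> by linarith
  qed
  have step: "\<exists>j\<in>T. sgn (v $ j) = l * sgn (v $ i)" if "i \<in> T" for i
  proof -
    have vi: "v $ i \<noteq> 0" and Pi: "P k d $ i = 0" for k using that by (auto simp: T_def)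
    have eq: "(\<Sum>j\<in>UNIV. M $ i $ j * u $ j) = u $ i"
      using Pi[of 0] by (simp add: P0 d_def M_nth)
    then have "0 < (\<Sum>j\<in>UNIV. M $ i $ j * u $ j)" using vi by (simp add: u_def)
    then obtain j where "0 < M $ i $ j * u $ j"
      using sum_pos_imp_ex_pos[of _ UNIV] M0 u0 by (meson mult_nonneg_nonneg)
    then have j: "0 < M $ i $ j" "v $ j \<noteq> 0"
      using M0[of i j] by (auto simp: zero_less_mult_iff u_def)
    \<comment> \<open>\<open>T\<close> is closed under following positive entries: a positive defect
      reached from \<open>j\<close> would be reached from \<open>i\<close> one step later.\<close>
    have "P k d $ j = 0" for k
      using Pd_step[OF j(1), of k] Pi[of "Suc k"] Pnn[OF d0, of k j] by force
    then have "j \<in> T" using j by (simp add: T_def)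
    have "sgn (of_real (M $ i $ j) * v $ j) = sgn (l * v $ i)"
      using eq j
      by (intro sgn_eq_of_norm_sum_eq[of UNIV])
        (auto simp: ev_nth norm_mult l u_def M0 cong: sum.cong)
    then have "sgn (v $ j) = l * sgn (v $ i)"
      using j l by (simp add: sgn_mult sgn_of_real) (simp add: sgn_eq)
    with \<open>j \<in> T\<close> show ?thesis by blast
  qed
  then obtain f where f: "\<And>i. i \<in> T \<Longrightarrow> f i \<in> T \<and> sgn (v $ f i) = l * sgn (v $ i)"
    by metis
  obtain i where i: "i \<in> T" using \<open>T \<noteq> {}\<close> by blast
  have walk: "(f ^^ k) i \<in> T \<and> sgn (v $ (f ^^ k) i) = l ^ k * sgn (v $ i)" for k
    by (induction k) (use i f in auto)
  \<comment> \<open>Pigeonhole: the walk stays in a finite index type, so it revisits an index, and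
    comparing phases there gives two equal powers of \<open>l\<close>.\<close>
  have "\<not> inj (\<lambda>k. (f ^^ k) i)"
    using finite_imageD[of "\<lambda>k. (f ^^ k) i" UNIV] by auto
  then obtain a b where ab: "a < b" "(f ^^ a) i = (f ^^ b) i"
    unfolding inj_def by (metis nat_neq_iff)
  have "sgn (v $ i) \<noteq> 0" using i by (simp add: T_def sgn_zero_iff)
  then have "l ^ a = l ^ b" using walk[of a] walk[of b] ab(2) by auto
  moreover have "l ^ b = l ^ a * l ^ (b - a)" using ab(1) by (simp flip: power_add)
  moreover have "l \<noteq> 0" using l by auto
  ultimately have "l ^ (b - a) = 1" by simp
  then show ?thesis using ab(1) by (intro exI[of _ "b - a"]) auto
qed

subsection \<open>Iterates on sums of eigenvectors\<close>

lemma matrix_power_mult_vec: "matrix_power M k *v x = ((*v) M ^^ k) x"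
  by (induction k) (simp_all flip: matrix_vector_mul_assoc)

lemma cmat_word_matrix_eigen:
  assumes "\<And>r. r \<in> set \<omega> \<Longrightarrow> cmat (A r) *v v = c r *s v"
  shows "cmat (word_matrix A \<omega>) *v v = prod_list (map c \<omega>) *s v"
  using assms
  by (induction \<omega>)
    (auto simp: cmat_mat_1 cmat_mult vector_scalar_commute mult.commute simp flip: matrix_vector_mul_assoc)

lemma cmat_power_sum_eigenvectors:
  fixes M :: "real^'n^'n"
  assumes "\<And>v. v \<in> E \<Longrightarrow> cmat M *v v = \<mu> v *s v"
  shows "((*v) (cmat M) ^^ k) (\<Sum>v\<in>E. \<alpha> v *s v) = (\<Sum>v\<in>E. (\<mu> v ^ k * \<alpha> v) *s v)"
proof (induction k)
  case (Suc k)
  have "cmat M *v (\<Sum>v\<in>E. (\<mu> v ^ k * \<alpha> v) *s v) = (\<Sum>v\<in>E. cmat M *v ((\<mu> v ^ k * \<alpha> v) *s v))"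
    by (simp add: vec.linear_sum[OF matrix_vector_mul_linear_gen])
  also have "\<dots> = (\<Sum>v\<in>E. (\<mu> v ^ Suc k * \<alpha> v) *s v)"
    by (rule sum.cong) (simp_all add: vector_scalar_commute assms mult_ac)
  finally show ?case using Suc.IH by simp
qed simp

text \<open>A real matrix commutes with taking real parts. This brings complex eigenvector
  expansions back to \<open>real^'n\<close>.\<close>

lemma Re_cmat_power:
  "((*v) M ^^ k) (\<chi> i. Re (z $ i)) = (\<chi> i. Re (((*v) (cmat M) ^^ k) z $ i))"
  by (induction k) (simp_all add: matrix_vector_mult_def map_matrix_def vec_eq_iff)

text \<open>Along multiples of \<open>q\<close> the coefficients of the vectors in \<open>F\<close>
  stay constant and all others decay geometrically. Defining \<open>\<xi>\<close> by real parts
  makes it a real vector by construction, whether or not \<open>F\<close> is closed under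
  conjugation.\<close>

lemma power_limit_sum_eigenvectors:
  fixes M :: "real^'n^'n" and q :: nat
  assumes fin: "finite E" and ev: "\<And>v. v \<in> E \<Longrightarrow> cmat M *v v = \<mu> v *s v"
    and F: "F \<subseteq> E" "\<And>v. v \<in> F \<Longrightarrow> \<mu> v ^ q = 1" "\<And>v. v \<in> E - F \<Longrightarrow> norm (\<mu> v) < 1"
    and q: "1 \<le> q" and x: "complex_vec x = (\<Sum>v\<in>E. \<alpha> v *s v)"
  defines "\<xi> \<equiv> \<chi> i. Re ((\<Sum>v\<in>F. \<alpha> v *s v) $ i)"
  shows "(\<lambda>k. matrix_power M (k * q) *v x) \<longlonglongrightarrow> \<xi>"
    and "periodic_point ((*v) M) \<xi>" and "period ((*v) M) \<xi> dvd q"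
proof -
  have x': "x = (\<chi> i. Re ((\<Sum>v\<in>E. \<alpha> v *s v) $ i))"
    unfolding x[symmetric] by (simp add: complex_vec_def vec_eq_iff)
  have "(\<lambda>k. (\<Sum>v\<in>E. (\<mu> v ^ (k * q) * \<alpha> v) *s v) $ i) \<longlonglongrightarrow>
      (\<Sum>v\<in>E. ((if v \<in> F then 1 else 0) * \<alpha> v) *s v) $ i" for i
    unfolding sum_component vector_smult_component
  proof (intro tendsto_sum tendsto_mult tendsto_const)
    fix v assume v: "v \<in> E"
    show "(\<lambda>k. \<mu> v ^ (k * q)) \<longlonglongrightarrow> (if v \<in> F then 1 else 0)"
    proof (cases "v \<in> F")
      case True
      then show ?thesis by (simp add: mult.commute[of _ q] power_mult F(2))
    next
      case False
      then have "norm (\<mu> v) < 1" using v F(3) by blast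
      then have "norm (\<mu> v ^ q) < 1"
        using q by (simp add: norm_power power_less_one_iff)
      then have "(\<lambda>k. (\<mu> v ^ q) ^ k) \<longlonglongrightarrow> 0" by (rule LIMSEQ_power_zero)
      then show ?thesis using False by (simp add: mult.commute[of _ q] power_mult)
    qed
  qed
  then have "(\<lambda>k. Re ((\<Sum>v\<in>E. (\<mu> v ^ (k * q) * \<alpha> v) *s v) $ i)) \<longlonglongrightarrow>
      Re ((\<Sum>v\<in>E. ((if v \<in> F then 1 else 0) * \<alpha> v) *s v) $ i)" for i
    by (rule tendsto_Re)
  moreover have pow: "((*v) (cmat M) ^^ k) (\<Sum>v\<in>E. \<alpha> v *s v) = (\<Sum>v\<in>E. (\<mu> v ^ k * \<alpha> v) *s v)" for k
    using ev by (rule cmat_power_sum_eigenvectors)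
  moreover have "(\<Sum>v\<in>E. ((if v \<in> F then 1 else 0) * \<alpha> v) *s v) = (\<Sum>v\<in>F. \<alpha> v *s v)"
    by (rule sum.mono_neutral_cong_right) (use fin F(1) in auto)
  ultimately show "(\<lambda>k. matrix_power M (k * q) *v x) \<longlonglongrightarrow> \<xi>"
    unfolding x' matrix_power_mult_vec Re_cmat_power pow \<xi>_def
    by (intro vec_tendstoI) (simp only: vec_lambda_beta)
  have "\<And>v. v \<in> F \<Longrightarrow> cmat M *v v = \<mu> v *s v" using ev F(1) by blast
  then have "((*v) (cmat M) ^^ q) (\<Sum>v\<in>F. \<alpha> v *s v) = (\<Sum>v\<in>F. (\<mu> v ^ q * \<alpha> v) *s v)"
    by (rule cmat_power_sum_eigenvectors)
  also have "\<dots> = (\<Sum>v\<in>F. \<alpha> v *s v)"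
    by (simp add: F(2))
  finally have "((*v) M ^^ q) \<xi> = \<xi>"
    unfolding \<xi>_def Re_cmat_power by simp
  then show "periodic_point ((*v) M) \<xi>" and "period ((*v) M) \<xi> dvd q"
    using q by (auto simp: periodic_point_def intro: least_power_minimal exI[of _ q])
qed

lemma prod_list_norm_le_1:
  fixes c :: "'a \<Rightarrow> complex"
  assumes "\<And>r. r \<in> set \<omega> \<Longrightarrow> norm (c r) \<le> 1"
  shows "norm (prod_list (map c \<omega>)) \<le> 1"
  using assms by (induction \<omega>) (auto simp: norm_mult intro: mult_le_one)

lemma prod_list_norm_less_1:
  fixes c :: "'a \<Rightarrow> complex"
  assumes "\<And>r. r \<in> set \<omega> \<Longrightarrow> norm (c r) \<le> 1" and "r \<in> set \<omega>" "norm (c r) < 1"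
  shows "norm (prod_list (map c \<omega>)) < 1"
  using assms
proof (induction \<omega>)
  case (Cons s \<omega>)
  have le: "norm (c s) \<le> 1" "norm (prod_list (map c \<omega>)) \<le> 1"
    using Cons.prems(1) by (auto intro: prod_list_norm_le_1)
  have "norm (c s) < 1 \<or> norm (prod_list (map c \<omega>)) < 1"
    using Cons by auto
  then have "norm (c s) * norm (prod_list (map c \<omega>)) < 1"
    using le by (metis mult.commute mult_left_le norm_ge_zero order_le_less_trans)
  then show ?case by (simp add: norm_mult)
qed simp

lemma prod_list_power_eq_1:
  fixes c :: "'a \<Rightarrow> complex"
  assumes "\<And>r. r \<in> set \<omega> \<Longrightarrow> c r ^ q = 1"
  shows "prod_list (map c \<omega>) ^ q = 1"
  using assms by (induction \<omega>) (auto simp: power_mult_distrib)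

theorem theorem2p1:
  fixes A :: "nat \<Rightarrow> real^'n^'n" and N :: nat and E :: "(complex^'n) set"
  assumes "1 \<le> N"
    and "\<And>r. r \<in> {1..N} \<Longrightarrow> nonneg_matrix (A r)"
    and "\<And>r. r \<in> {1..N} \<Longrightarrow> spectral_radius (A r) = 1"
    and "N = 2 \<Longrightarrow> partially_commuting (A 1) (A 2) \<or> quasi_commuting {A 1, A 2}
                 \<or> Laffey_pair (A 1) (A 2)"
    and "3 \<le> N \<Longrightarrow> quasi_commuting (A ` {1..N})"
    and "common_eigenvector_list (A ` {1..N}) E"
  shows "(\<forall>p \<omega> x. 1 \<le> p \<longrightarrow> \<omega> \<in> words N p \<longrightarrow> complex_vec x \<in> LC E \<longrightarrow>
            (\<exists>q\<ge>1. \<exists>\<xi>. (\<lambda>k. matrix_power (word_matrix A \<omega>) (k * q) *v x) \<longlonglongrightarrow> \<xi> \<and>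
               periodic_point ((*v) (word_matrix A \<omega>)) \<xi> \<and>
               period ((*v) (word_matrix A \<omega>)) \<xi> dvd q))
       \<and> (\<forall>x. complex_vec x \<in> LC E \<longrightarrow>
            (\<exists>q\<ge>1. \<exists>\<xi>. \<forall>p \<omega>. N \<le> p \<longrightarrow> \<omega> \<in> words N p \<longrightarrow>
               (\<forall>r\<in>{1..N}. \<exists>j<p. \<omega> ! j = r) \<longrightarrow>
               (\<lambda>k. matrix_power (word_matrix A \<omega>) (k * q) *v x) \<longlonglongrightarrow> \<xi> \<and>
               periodic_point ((*v) (word_matrix A \<omega>)) \<xi> \<and>
               period ((*v) (word_matrix A \<omega>)) \<xi> dvd q))"
proof -
  have fin: "finite E" and sub: "E \<subseteq> common_eigenvectors (A ` {1..N})"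
    using assms(6) by (auto simp: common_eigenvector_list_def)
  have "\<forall>v\<in>E. \<forall>r\<in>{1..N}. \<exists>l. eigenvector (cmat (A r)) v l"
    using sub by (auto simp: common_eigenvectors_def)
  then obtain c where c: "\<And>v r. v \<in> E \<Longrightarrow> r \<in> {1..N} \<Longrightarrow> eigenvector (cmat (A r)) v (c v r)"
    by metis
  have norm_c: "norm (c v r) \<le> 1" if "v \<in> E" "r \<in> {1..N}" for v r
    using norm_eigenvalue_le_spectral_radius[OF c[OF that]] assms(3)[OF that(2)] by simp
  \<comment> \<open>The implication sits under the quantifier so that a positive \<open>m\<close>
    exists for every pair, including those with eigenvalue inside the unit disc; this keeps the
    product \<open>q\<close> positive.\<close>
  have "\<exists>m>0. norm (c v r) = 1 \<longrightarrow> c v r ^ m = 1" if "v \<in> E" "r \<in> {1..N}" for v r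
    using peripheral_eigenvalue_root_of_unity[OF assms(2)[OF that(2)] _ c[OF that]]
      assms(3)[OF that(2)] by fastforce
  then obtain m where m: "\<And>v r. v \<in> E \<Longrightarrow> r \<in> {1..N} \<Longrightarrow>
      0 < m v r \<and> (norm (c v r) = 1 \<longrightarrow> c v r ^ m v r = (1::complex))"
    by metis
  \<comment> \<open>A common multiple of all exponents, chosen before any word or vector; it serves
    both claims.\<close>
  define q :: nat where "q = (\<Prod>v\<in>E. \<Prod>r\<in>{1..N}. m v r)"
  have "0 < q" unfolding q_def using m by (intro prod_pos) auto
  then have q: "1 \<le> q" by simp
  have root: "c v r ^ q = 1" if "v \<in> E" "r \<in> {1..N}" "norm (c v r) = 1" for v r
  proof -
    have "m v r dvd (\<Prod>r\<in>{1..N}. m v r)" using that by (intro dvd_prodI) auto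
    also have "\<dots> dvd q" unfolding q_def using that fin by (intro dvd_prodI) auto
    finally obtain k where "q = m v r * k" by blast
    then show ?thesis using m that by (simp add: power_mult)
  qed
  \<comment> \<open>The surviving eigenvectors depend on a word only through its set of letters,
    hence the limit does too.\<close>
  define F where "F R = {v \<in> E. \<forall>r\<in>R. norm (c v r) = 1}" for R
  have lim: "(\<lambda>k. matrix_power (word_matrix A \<omega>) (k * q) *v x) \<longlonglongrightarrow> \<xi> \<and>
      periodic_point ((*v) (word_matrix A \<omega>)) \<xi> \<and> period ((*v) (word_matrix A \<omega>)) \<xi> dvd q"
    if w: "set \<omega> \<subseteq> {1..N}" and x: "complex_vec x = (\<Sum>v\<in>E. \<alpha> v *s v)"
      and \<xi>: "\<xi> = (\<chi> i. Re ((\<Sum>v\<in>F (set \<omega>). \<alpha> v *s v) $ i))" for \<omega> x \<alpha> \<xi>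
  proof -
    have ev: "cmat (word_matrix A \<omega>) *v v = prod_list (map (c v) \<omega>) *s v" if "v \<in> E" for v
      using c[OF that] w by (intro cmat_word_matrix_eigen) (auto simp: eigenvector_def)
    have one: "prod_list (map (c v) \<omega>) ^ q = 1" if "v \<in> F (set \<omega>)" for v
      using that w by (intro prod_list_power_eq_1 root) (auto simp: F_def)
    have less: "norm (prod_list (map (c v) \<omega>)) < 1" if v: "v \<in> E - F (set \<omega>)" for v
    proof -
      obtain r where r: "r \<in> set \<omega>" "norm (c v r) \<noteq> 1" using v by (auto simp: F_def)
      have le: "norm (c v s) \<le> 1" if "s \<in> set \<omega>" for s
        using norm_c[of v s] v w that by blast
      show ?thesis
        using le[OF r(1)] r by (intro prod_list_norm_less_1[of \<omega> "c v" r] le) auto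
    qed
    have FE: "F (set \<omega>) \<subseteq> E" by (auto simp: F_def)
    show ?thesis
      unfolding \<xi> by (intro conjI power_limit_sum_eigenvectors[OF fin ev FE one less q x])
  qed
  have LC_E: "\<exists>\<alpha>. complex_vec x = (\<Sum>v\<in>E. \<alpha> v *s v)" if "complex_vec x \<in> LC E" for x
    using that unfolding LC_def by blast
  show ?thesis
  proof (intro conjI allI impI)
    fix p \<omega> and x :: "real^'n" assume w: "\<omega> \<in> words N p" and "complex_vec x \<in> LC E"
    then obtain \<alpha> where x: "complex_vec x = (\<Sum>v\<in>E. \<alpha> v *s v)" using LC_E by blast
    show "\<exists>q\<ge>1. \<exists>\<xi>. (\<lambda>k. matrix_power (word_matrix A \<omega>) (k * q) *v x) \<longlonglongrightarrow> \<xi> \<and>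
               periodic_point ((*v) (word_matrix A \<omega>)) \<xi> \<and>
               period ((*v) (word_matrix A \<omega>)) \<xi> dvd q"
      using lim[OF _ x refl] w q by (auto simp: words_def)
  next
    fix x :: "real^'n" assume "complex_vec x \<in> LC E"
    \<comment> \<open>The coefficients are fixed before the word is introduced, so the limit built
      from them and \<open>F {1..N}\<close> is the same for all words.\<close>
    then obtain \<alpha> where x: "complex_vec x = (\<Sum>v\<in>E. \<alpha> v *s v)" using LC_E by blast
    show "\<exists>q\<ge>1. \<exists>\<xi>. \<forall>p \<omega>. N \<le> p \<longrightarrow> \<omega> \<in> words N p \<longrightarrow>
               (\<forall>r\<in>{1..N}. \<exists>j<p. \<omega> ! j = r) \<longrightarrow>
               (\<lambda>k. matrix_power (word_matrix A \<omega>) (k * q) *v x) \<longlonglongrightarrow> \<xi> \<and>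
               periodic_point ((*v) (word_matrix A \<omega>)) \<xi> \<and>
               period ((*v) (word_matrix A \<omega>)) \<xi> dvd q"
    proof (intro exI[of _ q] conjI[OF q] exI allI impI)
      fix p \<omega> assume "\<omega> \<in> words N p" "\<forall>r\<in>{1..N}. \<exists>j<p. \<omega> ! j = r"
      then have "set \<omega> = {1..N}" by (force simp: words_def set_conv_nth)
      then show "(\<lambda>k. matrix_power (word_matrix A \<omega>) (k * q) *v x)
              \<longlonglongrightarrow> (\<chi> i. Re ((\<Sum>v\<in>F {1..N}. \<alpha> v *s v) $ i)) \<and>
            periodic_point ((*v) (word_matrix A \<omega>))
              (\<chi> i. Re ((\<Sum>v\<in>F {1..N}. \<alpha> v *s v) $ i)) \<and>
            period ((*v) (word_matrix A \<omega>))
              (\<chi> i. Re ((\<Sum>v\<in>F {1..N}. \<alpha> v *s v) $ i)) dvd q"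
        by (intro lim[OF _ x]) auto
    qed
  qed
qed

end
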